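(* Let $n>1$ be a positive odd integer and let $m$ be either $n-1$ or $(n+1)/2$. Then \[ \sum_{k=0}^{m}[4k-1]\frac{(q^{-1};q^2)_k^4}{(q^2;q^2)_k^4}\, q^{4k} \equiv 0 \pmod{[n]\Phi_n(q)^2}. \]
   Context: Here $q$ is an indeterminate. For $x$ and a base $p$ (a power of $q$), $(x;p)_k=\prod_{j=0}^{k-1}(1-xp^j)$ for integers $k\ge0$. The $q$-integer is $[j]=(1-q^j)/(1-q)$ (so $[j]=1+q+\cdots+q^{j-1}$ for $j\ge1$), and $\Phi_n(q)$ is the $n$-th cyclotomic polynomial. For rational functions $A(q),B(q)$ and a polynomial $P(q)$, $A\equiv B\pmod{P}$ means that the numerator of the reduced form of $A-B$ is divisible by $P$ in $\mathbb{Z}[q]$. *)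

theory Defs
  imports Complex_Main "HOL-Computational_Algebra.Computational_Algebra"
begin

text \<open>The field of rational functions in the indeterminate q is the fraction field of
  \<open>int poly\<close>, so that numerators and denominators of reduced forms live in \<open>\<int>[q]\<close>.\<close>

definition qX :: "int poly fract" where
  "qX = to_fract [:0, 1:]"

definition qpoch :: "'a :: comm_ring_1 \<Rightarrow> 'a \<Rightarrow> nat \<Rightarrow> 'a" where
  "qpoch x p k = (\<Prod>j<k. 1 - x * p ^ j)"

text \<open>The index is an integer: \<open>[-1] = - 1 / q\<close> occurs as a coefficient.\<close>

definition q_int :: "int \<Rightarrow> int poly fract" where
  "q_int j = (1 - qX powi j) / (1 - qX)"

text \<open>For natural indices the q-integer is a polynomial, and only as such can it be a
  factor of a modulus.\<close>

definition q_int_poly :: "nat \<Rightarrow> int poly" where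
  "q_int_poly n = (\<Sum>i<n. monom 1 i)"

definition primitive_root_of_unity :: "nat \<Rightarrow> complex \<Rightarrow> bool" where
  "primitive_root_of_unity n z \<longleftrightarrow> z ^ n = 1 \<and> (\<forall>k. 0 < k \<and> k < n \<longrightarrow> z ^ k \<noteq> 1)"

text \<open>The integer polynomial whose image over the complex numbers is the product of
  \<open>x - z\<close> over the primitive n-th roots of unity z (existence and uniqueness are shown
  below in \<open>of_int_cyclotomic\<close>). Meaningful for \<open>n > 0\<close>.\<close>

definition cyclotomic :: "nat \<Rightarrow> int poly" where
  "cyclotomic n =
     (THE p. map_poly complex_of_int p = (\<Prod>z | primitive_root_of_unity n z. [:-z, 1:]))"

text \<open>Here \<open>quot_of_fract\<close> yields the numerator and denominator in lowest terms over \<open>\<int>[q]\<close>.\<close>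

definition qcong :: "int poly fract \<Rightarrow> int poly fract \<Rightarrow> int poly \<Rightarrow> bool" where
  "qcong A B P \<longleftrightarrow> P dvd fst (quot_of_fract (A - B))"

lemma qX_neq_1: "qX \<noteq> 1"
proof -
  have "[:0, 1:] \<noteq> (1 :: int poly)" by (simp add: one_pCons)
  then show ?thesis unfolding qX_def by (metis to_fract_1 to_fract_eq_iff)
qed

lemma to_fract_monom: "to_fract (monom 1 i) = qX ^ i"
proof (induction i)
  case 0
  show ?case by (simp add: monom_0 flip: one_pCons)
next
  case (Suc i)
  have "monom 1 (Suc i) = [:0, 1:] * (monom 1 i :: int poly)"
    by (simp add: monom_Suc)
  then show ?case using Suc.IH by (simp only: to_fract_mult qX_def power_Suc)
qed

lemma to_fract_q_int_poly: "to_fract (q_int_poly n) = q_int (int n)"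
proof -
  have "to_fract (q_int_poly n) = (\<Sum>i<n. qX ^ i)"
    by (simp add: q_int_poly_def to_fract_monom)
  also have "\<dots> = (1 - qX ^ n) / (1 - qX)"
    using sum_gp_strict[of qX n] qX_neq_1 by simp
  finally show ?thesis by (simp add: q_int_def)
qed

abbreviation "cpoly \<equiv> map_poly complex_of_int"

lemma cpoly_mult: "cpoly (p * r) = cpoly p * cpoly r"
  by (rule poly_eqI) (simp add: coeff_map_poly coeff_mult)

lemma cpoly_add: "cpoly (p + r) = cpoly p + cpoly r"
  by (rule poly_eqI) (simp add: coeff_map_poly)

lemma cpoly_diff: "cpoly (p - r) = cpoly p - cpoly r"
  by (rule poly_eqI) (simp add: coeff_map_poly)

lemma cpoly_monom: "cpoly (monom 1 n) = monom 1 n"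
  by (rule poly_eqI) (simp add: coeff_map_poly)

lemma cpoly_1: "cpoly 1 = 1"
  by (simp add: map_poly_1)

lemma cpoly_prod: "cpoly (\<Prod>x\<in>A. f x) = (\<Prod>x\<in>A. cpoly (f x))"
  by (induction A rule: infinite_finite_induct) (simp_all add: cpoly_mult cpoly_1)

lemma cpoly_inject: "cpoly p = cpoly r \<longleftrightarrow> p = r"
  by (auto simp: poly_eq_iff coeff_map_poly)

lemma degree_cpoly: "degree (cpoly p) = degree p"
  by (simp add: degree_map_poly)

lemma prod_linear_monic:
  fixes A :: "complex set"
  assumes "finite A"
  shows "lead_coeff (\<Prod>z\<in>A. [:-z, 1:]) = 1" "degree (\<Prod>z\<in>A. [:-z, 1:]) = card A"
proof -
  show "lead_coeff (\<Prod>z\<in>A. [:-z, 1:]) = 1" unfolding lead_coeff_prod by simp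
  show "degree (\<Prod>z\<in>A. [:-z, 1:]) = card A" by (simp add: degree_prod_eq_sum_degree)
qed

lemma prod_roots_of_unity:
  assumes "n > 0"
  shows "(\<Prod>z | z ^ n = (1 :: complex). [:-z, 1:]) = monom 1 n - 1"
proof -
  let ?R = "{z. z ^ n = (1 :: complex)}"
  let ?P = "\<Prod>z\<in>?R. [:-z, 1:]"
  let ?D = "?P - (monom 1 n - 1)"
  have fin: "finite ?R" using finite_roots_unity[of n] assms by simp
  have card: "card ?R = n" by (rule card_roots_unity_eq[OF assms])
  have degP: "degree ?P = n" using prod_linear_monic(2)[OF fin] card by simp
  have lead: "coeff ?P n = 1" using prod_linear_monic(1)[OF fin] degP by simp
  have "?D = 0"
  proof (rule ccontr)
    assume ne: "?D \<noteq> 0"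
    have "coeff ?D i = 0" if "i \<ge> n" for i
      using that lead assms degP
      by (cases "i = n") (auto simp: coeff_eq_0)
    then have deg: "degree ?D < n"
      using ne by (metis leading_coeff_0_iff not_le)
    have "?R \<subseteq> {z. poly ?D z = 0}"
      using fin by (auto simp: poly_prod poly_monom)
    then have "card ?R \<le> card {z. poly ?D z = 0}"
      by (rule card_mono[OF poly_roots_finite[OF ne]])
    also have "\<dots> \<le> degree ?D" by (rule card_poly_roots_bound[OF ne])
    finally show False using deg card by linarith
  qed
  then show ?thesis by (simp only: right_minus_eq)
qed

lemma primitive_root_partition:
  assumes "n > 0"
  shows "{z. z ^ n = (1 :: complex)} = (\<Union>d\<in>{d. d dvd n}. {z. primitive_root_of_unity d z})"
proof (intro equalityI subsetI)
  fix z :: complex assume "z \<in> {z. z ^ n = 1}"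
  then have z: "z ^ n = 1" by simp
  define d where "d = (LEAST k. 0 < k \<and> z ^ k = 1)"
  have d: "0 < d \<and> z ^ d = 1" unfolding d_def
    by (rule LeastI[of _ n]) (use z assms in simp)
  have least: "z ^ k \<noteq> 1" if "0 < k" "k < d" for k
    using that not_less_Least[of k "\<lambda>k. 0 < k \<and> z ^ k = 1"] unfolding d_def by blast
  have "z ^ n = z ^ (d * (n div d) + n mod d)" by simp
  also have "\<dots> = (z ^ d) ^ (n div d) * z ^ (n mod d)"
    by (simp only: power_mult power_add)
  finally have "z ^ n = (z ^ d) ^ (n div d) * z ^ (n mod d)" .
  then have "z ^ (n mod d) = 1" using z d by simp
  moreover have "n mod d < d" using d by simp
  ultimately have "n mod d = 0" using least by blast
  then have "d dvd n" by auto
  then show "z \<in> (\<Union>d\<in>{d. d dvd n}. {z. primitive_root_of_unity d z})"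
    using d least by (auto simp: primitive_root_of_unity_def)
next
  fix z assume "z \<in> (\<Union>d\<in>{d. d dvd n}. {z. primitive_root_of_unity d z})"
  then show "z \<in> {z. z ^ n = 1}"
    by (auto simp: primitive_root_of_unity_def power_mult elim!: dvdE)
qed

lemma finite_primitive_roots:
  assumes "n > 0" shows "finite {z. primitive_root_of_unity n z}"
proof (rule finite_subset)
  show "finite {z :: complex. z ^ n = 1}" using finite_roots_unity[of n] assms by simp
qed (auto simp: primitive_root_of_unity_def)

lemma primitive_roots_disjoint:
  assumes "d > 0" "e > 0" "primitive_root_of_unity d z" "primitive_root_of_unity e z"
  shows "d = e"
  using assms unfolding primitive_root_of_unity_def by (metis nat_neq_iff)

lemma prod_primitive_roots:
  assumes "n > 0"
  shows "(\<Prod>d | d dvd n. \<Prod>z | primitive_root_of_unity d z. [:-z, 1:]) = monom 1 n - 1"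
proof -
  have pos: "d > 0" if "d dvd n" for d using that assms by (auto intro: Nat.gr0I)
  have "(\<Prod>z | z ^ n = (1 :: complex). [:-z, 1:]) =
        (\<Prod>d | d dvd n. \<Prod>z | primitive_root_of_unity d z. [:-z, 1:])"
    unfolding primitive_root_partition[OF assms]
  proof (rule prod.UNION_disjoint)
    show "finite {d. d dvd n}" using assms by simp
    show "\<forall>d\<in>{d. d dvd n}. finite {z. primitive_root_of_unity d z}"
      using pos finite_primitive_roots by blast
    show "\<forall>d\<in>{d. d dvd n}. \<forall>e\<in>{d. d dvd n}. d \<noteq> e \<longrightarrow>
            {z. primitive_root_of_unity d z} \<inter> {z. primitive_root_of_unity e z} = {}"
      using pos primitive_roots_disjoint by blast
  qed
  then show ?thesis using prod_roots_of_unity[OF assms] by simp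
qed

lemma cyclotomic_exists:
  assumes "n > 0"
  shows "\<exists>p. cpoly p = (\<Prod>z | primitive_root_of_unity n z. [:-z, 1:])"
  using assms
proof (induction n rule: less_induct)
  case (less n)
  let ?C = "\<lambda>d. \<Prod>z | primitive_root_of_unity d z. [:-z, 1:]"
  let ?E = "{d. d dvd n \<and> d < n}"
  have "\<exists>p. cpoly p = ?C d" if "d \<in> ?E" for d
    using that less by (auto intro!: less.IH Nat.gr0I)
  then obtain f where f: "cpoly (f d) = ?C d" if "d \<in> ?E" for d by metis
  define Q where "Q = (\<Prod>d\<in>?E. f d)"
  have Q: "cpoly Q = (\<Prod>d\<in>?E. ?C d)"
    unfolding Q_def cpoly_prod by (rule prod.cong) (simp_all add: f)
  have ins: "{d. d dvd n} = insert n ?E"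
    using less.prems by (auto dest: dvd_imp_le)
  have fact: "monom 1 n - 1 = ?C n * cpoly Q"
    unfolding Q prod_primitive_roots[OF less.prems, symmetric] ins
    by (subst prod.insert) auto
  have "lead_coeff (?C d) = 1" if "d \<in> ?E" for d
    using that less.prems
    by (intro prod_linear_monic finite_primitive_roots) (auto intro: Nat.gr0I)
  then have "lead_coeff (cpoly Q) = 1" unfolding Q by (simp add: lead_coeff_prod)
  then have monic: "lead_coeff Q = 1" by (simp add: degree_cpoly coeff_map_poly)
  then have Q0: "Q \<noteq> 0" by auto
  obtain D R where DR: "pseudo_divmod (monom 1 n - 1) Q = (D, R)" by fastforce
  have eq: "monom 1 n - 1 = Q * D + R" and R: "R = 0 \<or> degree R < degree Q"
    using pseudo_divmod[OF Q0 DR] monic by simp_all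
  have "?C n * cpoly Q = cpoly Q * cpoly D + cpoly R"
    unfolding fact[symmetric] cpoly_mult[symmetric] cpoly_add[symmetric] eq[symmetric]
    by (simp add: cpoly_diff cpoly_monom cpoly_1)
  then have R': "cpoly Q * (?C n - cpoly D) = cpoly R" by (simp add: algebra_simps)
  have "?C n - cpoly D = 0"
  proof (rule ccontr)
    assume ne: "?C n - cpoly D \<noteq> 0"
    have Q0': "cpoly Q \<noteq> 0" using Q0 cpoly_inject[of Q 0] by simp
    have "degree (cpoly R) = degree (cpoly Q) + degree (?C n - cpoly D)"
      unfolding R'[symmetric] by (rule degree_mult_eq[OF Q0' ne])
    moreover have "cpoly R \<noteq> 0" unfolding R'[symmetric] using Q0' ne by simp
    ultimately show False using R by (auto simp: degree_cpoly)
  qed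
  then show ?case by (intro exI[of _ D]) simp
qed

lemma of_int_cyclotomic:
  assumes "n > 0"
  shows "map_poly complex_of_int (cyclotomic n) =
         (\<Prod>z | primitive_root_of_unity n z. [:-z, 1:])"
proof -
  have "\<exists>!p. cpoly p = (\<Prod>z | primitive_root_of_unity n z. [:-z, 1:])"
    using cyclotomic_exists[OF assms] by (metis cpoly_inject)
  then show ?thesis unfolding cyclotomic_def by (rule theI')
qed

end

theory Submission
  imports Defs "HOL-Computational_Algebra.Field_as_Ring"
begin

text \<open>The truncated sum has a closed form: up to a factor \<open>W / (q (1 - q)\<^sup>2)\<close> with a polynomial W it is
  the fourth power of \<open>(q;q\<^sup>2)\<^sub>m / (q\<^sup>2;q\<^sup>2)\<^sub>m\<close>. At every root of unity \<open>z \<noteq> 1\<close> with \<open>z\<^sup>n = 1\<close>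
  the numerator \<open>(q;q\<^sup>2)\<^sub>m\<close> vanishes to higher order than \<open>(q\<^sup>2;q\<^sup>2)\<^sub>m\<close>, because for either
  value of m there are more odd than even exponents e up to 2m with \<open>z\<^sup>e = 1\<close>. Hence the cube
  of \<open>[n]\<close>, a multiple of the modulus, divides the reduced numerator over the complex numbers, and
  over the integers because the modulus is monic.\<close>

section \<open>Closed form of the truncated sum over an arbitrary field\<close>

lemma qpoch_Suc: "qpoch x p (Suc k) = qpoch x p k * (1 - x * p ^ k)"
  by (simp add: qpoch_def)

text \<open>The factor for \<open>j = 0\<close> splits off, and in the others
  \<open>inverse q * q ^ 2 = q\<close>. The summands thus involve the same product as the closed
  form.\<close>

lemma qpoch_inverse_Suc:
  fixes q :: "'a :: field"
  assumes "q \<noteq> 0"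
  shows "qpoch (inverse q) (q ^ 2) (Suc k) = (1 - inverse q) * qpoch q (q ^ 2) k"
proof -
  have "inverse q * (q ^ 2) ^ Suc j = q * (q ^ 2) ^ j" for j
    using assms by (simp add: power2_eq_square)
  then show ?thesis
    by (simp only: qpoch_def prod.lessThan_Suc_shift) simp
qed

text \<open>Induction on m: with \<open>q ^ (2 * m)\<close> abbreviated to Q, adding the next
  summand comes down to a polynomial identity in q and Q. The hypothesis \<open>qp\<close> makes the
  new denominator factor \<open>1 - q ^ 2 * Q\<close> nonzero.\<close>

lemma truncated_sum_closed_form:
  fixes q :: "'a :: field"
  assumes q0: "q \<noteq> 0" and q1: "q \<noteq> 1" and qp: "\<And>j. j > 0 \<Longrightarrow> q ^ (2 * j) \<noteq> 1"
  shows "(\<Sum>k = 0..m. (1 - q powi (4 * int k - 1)) / (1 - q)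
            * (qpoch (inverse q) (q ^ 2) k ^ 4 / qpoch (q ^ 2) (q ^ 2) k ^ 4) * q ^ (4 * k))
       = - (1 + q - 4 * q * q ^ (2 * m) + q * (1 + q) * q ^ (4 * m)) / (q * (1 - q) ^ 2)
            * (qpoch q (q ^ 2) m ^ 4 / qpoch (q ^ 2) (q ^ 2) m ^ 4)"
proof (induction m)
  case 0
  \<comment> \<open>Both sides equal \<open>- 1 / q\<close>, the value of the q-integer at
    -1.\<close>
  have "1 - 1 / q = - ((1 - q) / q)" using q0 by (simp add: field_simps)
  moreover have "1 + q - 4 * q + q * (1 + q) = (1 - q) ^ 2"
    by (simp add: algebra_simps power2_eq_square)
  ultimately show ?case using q0 q1
    by (simp add: qpoch_def power_int_minus inverse_eq_divide)
next
  case (Suc m)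
  define Q where "Q = q ^ (2 * m)"
  define A where "A = qpoch q (q ^ 2) m"
  define E where "E = qpoch (q ^ 2) (q ^ 2) m"
  have Q2: "q ^ (4 * m) = Q ^ 2" by (simp add: Q_def flip: power_mult)
  have F0: "1 - q ^ 2 * Q \<noteq> 0"
    using qp[of "Suc m"] by (simp add: Q_def power_add power2_eq_square mult.assoc)
  have A': "qpoch q (q ^ 2) (Suc m) = A * (1 - q * Q)"
    by (simp add: qpoch_Suc A_def Q_def power_mult)
  have E': "qpoch (q ^ 2) (q ^ 2) (Suc m) = E * (1 - q ^ 2 * Q)"
    by (simp add: qpoch_Suc E_def Q_def power_mult)
  have B': "qpoch (inverse q) (q ^ 2) (Suc m) = - ((1 - q) / q) * A"
    using q0 unfolding qpoch_inverse_Suc[OF q0] A_def by (simp add: field_simps)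
  have p1: "q powi (4 * int (Suc m) - 1) = q ^ 3 * Q ^ 2"
  proof -
    have "4 * int (Suc m) - 1 = int (3 + 4 * m)" by simp
    then show ?thesis by (simp only: power_int_of_nat power_add Q2)
  qed
  have p2: "q ^ (4 * Suc m) = q ^ 4 * Q ^ 2" "q ^ (2 * Suc m) = q ^ 2 * Q"
    by (simp_all add: power_add Q2 Q_def power2_eq_square)
  \<comment> \<open>The inductive step with the common denominator and the factor
    \<open>A ^ 4\<close> removed; it holds for arbitrary q and Q.\<close>
  have step: "- (1 + q - 4 * q * Q + q * (1 + q) * Q ^ 2) * (1 - q ^ 2 * Q) ^ 4
      + q * (1 - q) ^ 5 * (1 - q ^ 3 * Q ^ 2) * Q ^ 2
      = - (1 + q - 4 * q * (q ^ 2 * Q) + q * (1 + q) * (q ^ 4 * Q ^ 2)) * (1 - q * Q) ^ 4"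
    by algebra
  \<comment> \<open>The closed form for m and the new summand are each brought over the denominator
    of the closed form for \<open>Suc m\<close>, so that \<open>step\<close> adds them.\<close>
  have "- (1 + q - 4 * q * Q + q * (1 + q) * Q ^ 2) / (q * (1 - q) ^ 2) * (A ^ 4 / E ^ 4)
      = (- (1 + q - 4 * q * Q + q * (1 + q) * Q ^ 2) * (1 - q ^ 2 * Q) ^ 4)
        * (A ^ 4 / (q * (1 - q) ^ 2 * (E * (1 - q ^ 2 * Q)) ^ 4))"
    using F0 by (simp add: power_mult_distrib)
  moreover have "(1 - q ^ 3 * Q ^ 2) / (1 - q) * ((- ((1 - q) / q) * A) ^ 4
        / (E * (1 - q ^ 2 * Q)) ^ 4) * (q ^ 4 * Q ^ 2)
      = (q * (1 - q) ^ 5 * (1 - q ^ 3 * Q ^ 2) * Q ^ 2)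
        * (A ^ 4 / (q * (1 - q) ^ 2 * (E * (1 - q ^ 2 * Q)) ^ 4))"
  proof -
    have "1 - q \<noteq> 0" using q1 by simp
    then obtain u where u: "u = 1 - q" "u \<noteq> 0" by blast
    show ?thesis using q0 u(2) unfolding u(1)[symmetric]
      by (simp add: power_mult_distrib power_divide divide_simps) (simp add: eval_nat_numeral)
  qed
  ultimately have "- (1 + q - 4 * q * Q + q * (1 + q) * Q ^ 2) / (q * (1 - q) ^ 2) * (A ^ 4 / E ^ 4)
      + (1 - q ^ 3 * Q ^ 2) / (1 - q) * ((- ((1 - q) / q) * A) ^ 4
        / (E * (1 - q ^ 2 * Q)) ^ 4) * (q ^ 4 * Q ^ 2)
      = (- (1 + q - 4 * q * (q ^ 2 * Q) + q * (1 + q) * (q ^ 4 * Q ^ 2)) * (1 - q * Q) ^ 4)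
        * (A ^ 4 / (q * (1 - q) ^ 2 * (E * (1 - q ^ 2 * Q)) ^ 4))"
    by (simp only: step distrib_right[symmetric])
  then show ?case
    unfolding sum.atLeast0_atMost_Suc Suc.IH
    unfolding A' E' B' p1 p2 Q2 A_def[symmetric] E_def[symmetric] Q_def[symmetric]
    by (simp only: power_mult_distrib) (simp add: ac_simps)
qed

section \<open>Divisibility and root multiplicities of polynomials\<close>

text \<open>For monic P pseudo-division is genuine division within the integer polynomials. The
  image of the remainder is divisible by that of P, so the remainder vanishes by its degree.\<close>

lemma dvd_of_cpoly_dvd:
  assumes "lead_coeff P = 1" and "cpoly P dvd cpoly A"
  shows "P dvd A"
proof -
  have P0: "P \<noteq> 0" using assms(1) by auto
  obtain D R where DR: "pseudo_divmod A P = (D, R)" by fastforce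
  have eq: "A = P * D + R" and R: "R = 0 \<or> degree R < degree P"
    using pseudo_divmod[OF P0 DR] assms(1) by simp_all
  have "cpoly A = cpoly P * cpoly D + cpoly R"
    by (simp only: eq cpoly_add cpoly_mult)
  with assms(2) have "cpoly P dvd cpoly R" by (metis dvd_add_right_iff dvd_triv_left)
  moreover have "cpoly R = 0 \<longleftrightarrow> R = 0" using cpoly_inject[of R 0] by simp
  ultimately have "R = 0" using R by (metis degree_cpoly dvd_imp_degree_le not_le)
  then show ?thesis using eq by simp
qed

text \<open>Two distinct monic linear factors differ by a nonzero constant, so they and their powers
  are coprime.\<close>

lemma prod_linear_power_dvd:
  fixes p :: "'a :: field_gcd poly"
  assumes "finite Z" and "\<And>z. z \<in> Z \<Longrightarrow> [:-z, 1:] ^ k dvd p"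
  shows "(\<Prod>z\<in>Z. [:-z, 1:]) ^ k dvd p"
proof -
  have coprime: "coprime [:-z, 1:] [:-w, 1:]" if "z \<noteq> w" for z w :: 'a
  proof (rule coprimeI)
    fix c assume "c dvd [:-z, 1:]" "c dvd [:-w, 1:]"
    then have "c dvd [:-z, 1:] - [:-w, 1:]" by (rule dvd_diff)
    moreover have "is_unit ([:-z, 1:] - [:-w, 1:])" using that by (simp add: is_unit_pCons_iff)
    ultimately show "is_unit c" by (rule dvd_unit_imp_unit)
  qed
  show ?thesis using assms
  proof (induction Z rule: finite_induct)
    case empty
    show ?case by simp
  next
    case (insert w Z)
    have "coprime [:-w, 1:] (\<Prod>z\<in>Z. [:-z, 1:])"
      using insert.hyps(2) by (intro prod_coprime_right coprime) auto
    then have "coprime ([:-w, 1:] ^ k) ((\<Prod>z\<in>Z. [:-z, 1:]) ^ k)" by simp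
    then have "[:-w, 1:] ^ k * (\<Prod>z\<in>Z. [:-z, 1:]) ^ k dvd p"
      using insert by (intro divides_mult) auto
    then show ?case by (simp only: prod.insert[OF insert.hyps] power_mult_distrib)
  qed
qed

text \<open>All roots are simple: the derivative is a nonzero multiple of the power
  \<open>k - 1\<close> of the indeterminate and can vanish only at 0, which is not a root.\<close>

lemma order_one_minus_monom:
  assumes "k > 0"
  shows "order z (1 - monom (1 :: complex) k) = of_bool (z ^ k = 1)"
proof -
  let ?p = "1 - monom (1 :: complex) k"
  have root: "poly ?p z = 0 \<longleftrightarrow> z ^ k = 1" for z by (auto simp: poly_monom)
  have "poly ?p 0 = 1" using assms by (simp add: poly_monom)
  then have p0: "?p \<noteq> 0" by (metis poly_0 zero_neq_one)
  have "pderiv ?p = - monom (of_nat k) (k - 1)" by (simp add: pderiv_diff pderiv_monom)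
  then have "rsquarefree ?p" using assms
    by (auto simp: rsquarefree_roots poly_monom power_0_left)
  then have "order z ?p \<le> 1" by (auto simp: rsquarefree_def le_Suc_eq)
  moreover have "order z ?p = 0 \<longleftrightarrow> z ^ k \<noteq> 1" using root[of z] p0 order_root[of ?p z] by blast
  ultimately show ?thesis by (cases "z ^ k = 1") simp_all
qed

lemma order_prod:
  fixes f :: "'a \<Rightarrow> 'b :: idom poly"
  assumes "finite A" and "\<And>x. x \<in> A \<Longrightarrow> f x \<noteq> 0"
  shows "order z (\<Prod>x\<in>A. f x) = (\<Sum>x\<in>A. order z (f x))"
  using assms
  by (induction A rule: finite_induct) (simp_all add: order_mult order_0I)

section \<open>Odd against even exponents at an n-th root of unity\<close>

text \<open>As n is odd, reflecting an even exponent to its complement in n or \<open>3 * n\<close>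
  gives an odd one and keeps the condition on z. The odd exponent n lies in the range for both
  values of m but is never hit.\<close>

lemma odd_multiples_outnumber_even:
  fixes z :: "'a :: field"
  assumes n: "n > 1" "odd n" and m: "m = n - 1 \<or> m = (n + 1) div 2"
    and z: "z ^ n = 1" "z \<noteq> 1"
  shows "card {j. j < m \<and> z ^ (2 * j + 2) = 1} < card {j. j < m \<and> z ^ (2 * j + 1) = 1}"
proof -
  let ?even = "{j. j < m \<and> z ^ (2 * j + 2) = 1}" and ?odd = "{j. j < m \<and> z ^ (2 * j + 1) = 1}"
  obtain h where h: "n = 2 * h + 1" using n(2) by (auto elim: oddE)
  have h0: "h > 0" using n h by simp
  \<comment> \<open>In terms of exponents, with \<open>e = 2 * j + 2\<close>, f sends e to \<open>n - e\<close> or \<open>3 * n - e\<close>; it misses n.\<close>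
  define f where "f j = (if j < h then h - 1 - j else 3 * h - j)" for j
  \<comment> \<open>Index h belongs to the exponent \<open>n + 1\<close>, which would force
    \<open>z = 1\<close>; the reflection may leave it out.\<close>
  have not_h: "j \<noteq> h" if "j \<in> ?even" for j
  proof
    assume "j = h"
    then have "z ^ (n + 1) = 1" using that h by simp
    then show False using z by simp
  qed
  have odd: "z ^ a = 1" if "z ^ b = 1" "a + b = n \<or> a + b = 3 * n" for a b
  proof -
    have "z ^ (a + b) = 1" using that(2) z(1) by (auto simp: power_mult mult.commute[of 3])
    then show ?thesis using that(1) by (simp add: power_add)
  qed
  have img: "f ` ?even \<subseteq> ?odd - {h}"
  proof
    fix i assume "i \<in> f ` ?even"
    then obtain j where j: "j \<in> ?even" "i = f j" by blast
    have jh: "j \<noteq> h" by (rule not_h[OF j(1)])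
    have "(2 * i + 1) + (2 * j + 2) = n \<or> (2 * i + 1) + (2 * j + 2) = 3 * n"
      using j jh m h h0 by (auto simp: f_def split: if_splits)
    then have "z ^ (2 * i + 1) = 1" using odd j(1) by blast
    \<comment> \<open>The first branch permutes the indices below h. The second occurs only for
      \<open>m = n - 1\<close>, where it permutes those strictly between h and
      \<open>2 * h = m\<close>.\<close>
    moreover have "i < m" "i \<noteq> h" using j jh m h h0 by (auto simp: f_def split: if_splits)
    ultimately show "i \<in> ?odd - {h}" by simp
  qed
  have h_odd: "h \<in> ?odd" using z h m h0 by auto
  have "inj_on f ?even"
  proof (rule inj_onI)
    fix i j assume "i \<in> ?even" "j \<in> ?even" "f i = f j"
    then show "i = j" using m h not_h[of i] not_h[of j]
      by (auto simp: f_def split: if_splits)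
  qed
  then have "card ?even = card (f ` ?even)" by (simp add: card_image)
  also have "\<dots> \<le> card (?odd - {h})" by (rule card_mono[OF _ img]) simp
  also have "\<dots> < card ?odd" by (rule card_Diff1_less[OF _ h_odd]) simp
  finally show ?thesis .
qed

section \<open>The q-integer and the cyclotomic polynomial over the complex numbers\<close>

text \<open>The geometric sum times \<open>monom 1 1 - 1\<close> telescopes to
  \<open>monom 1 n - 1\<close>, and the linear factor of the root 1 cancels.\<close>

lemma cpoly_q_int_poly:
  assumes "n > 0"
  shows "cpoly (q_int_poly n) = (\<Prod>z | z ^ n = 1 \<and> z \<noteq> 1. [:-z, 1:])"
proof -
  have gp: "q_int_poly n * (monom 1 1 - 1) = monom 1 n - 1"
  proof (induction n)
    case (Suc n)
    then show ?case by (simp add: q_int_poly_def algebra_simps mult_monom)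
  qed (simp add: q_int_poly_def monom_0 flip: one_pCons)
  have x: "monom 1 (Suc 0) - 1 = [:-1, 1 :: complex:]" by (simp add: monom_Suc monom_0 one_pCons)
  have "cpoly (q_int_poly n) * cpoly (monom 1 1 - 1) = cpoly (monom 1 n - 1)"
    by (simp only: cpoly_mult[symmetric] gp)
  then have "cpoly (q_int_poly n) * [:-1, 1:] = monom 1 n - 1"
    by (simp only: cpoly_diff cpoly_monom cpoly_1) (simp add: x)
  also have "\<dots> = [:-1, 1:] * (\<Prod>z\<in>{z. z ^ n = 1} - {1}. [:-z, 1:])"
    using finite_roots_unity[of n] assms
    by (simp only: prod_roots_of_unity[OF assms, symmetric]) (subst prod.remove[of _ 1]; simp)
  finally have "[:-1, 1:] * cpoly (q_int_poly n) = [:-1, 1:] * (\<Prod>z\<in>{z. z ^ n = 1} - {1}. [:-z, 1:])"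
    by (simp only: mult.commute)
  then have "cpoly (q_int_poly n) = (\<Prod>z\<in>{z. z ^ n = 1} - {1}. [:-z, 1:])"
    by (subst (asm) mult_cancel_left) simp
  moreover have "{z :: complex. z ^ n = 1} - {1} = {z. z ^ n = 1 \<and> z \<noteq> 1}" by auto
  ultimately show ?thesis by simp
qed

text \<open>For \<open>n > 1\<close> a primitive root is not 1, hence it is among the roots of the
  q-integer. This makes the modulus a divisor of the cube of the q-integer.\<close>

lemma cyclotomic_dvd_q_int_poly:
  assumes "n > 1"
  shows "cpoly (cyclotomic n) dvd cpoly (q_int_poly n)"
proof -
  have "{z. primitive_root_of_unity n z} \<subseteq> {z. z ^ n = 1 \<and> z \<noteq> 1}"
    using assms by (force simp: primitive_root_of_unity_def)
  moreover have "finite {z :: complex. z ^ n = 1 \<and> z \<noteq> 1}"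
    using finite_roots_unity[of n] assms by (auto intro: finite_subset[rotated])
  ultimately show ?thesis using assms
    by (simp add: of_int_cyclotomic cpoly_q_int_poly prod_dvd_prod_subset)
qed

section \<open>From the closed form to the congruence by comparing multiplicities\<close>

theorem theorem5p3:
  fixes n m :: nat
  assumes "n > 1" and "odd n"
    and "m = n - 1 \<or> m = (n + 1) div 2"
  shows "qcong
    (\<Sum>k = 0..m. q_int (4 * int k - 1)
        * (qpoch (inverse qX) (qX ^ 2) k ^ 4 / qpoch (qX ^ 2) (qX ^ 2) k ^ 4) * qX ^ (4 * k))
    0 (q_int_poly n * cyclotomic n ^ 2)"
proof -
  define X :: "int poly" where "X = [:0, 1:]"
  define V where "V = X * (1 - X) ^ 2"
  define W where "W = 1 + X - 4 * X * X ^ (2 * m) + X * (1 + X) * X ^ (4 * m)"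
  \<comment> \<open>The two q-shifted factorials as polynomials with factors
    \<open>1 - q ^ e\<close>, e even in \<open>Ev\<close> and odd in \<open>Od\<close>: the
    multiplicity of z in each counts the e with \<open>z ^ e = 1\<close>.\<close>
  define Ev where "Ev = (\<Prod>j<m. 1 - monom (1 :: int) (2 * j + 2))"
  define Od where "Od = (\<Prod>j<m. 1 - monom (1 :: int) (2 * j + 1))"
  define S where "S = (\<Sum>k = 0..m. q_int (4 * int k - 1)
        * (qpoch (inverse qX) (qX ^ 2) k ^ 4 / qpoch (qX ^ 2) (qX ^ 2) k ^ 4) * qX ^ (4 * k))"
  have f_power: "to_fract (p ^ k) = to_fract p ^ k" for p :: "int poly" and k
    by (induction k) simp_all
  have fX: "to_fract X = qX" by (simp add: X_def qX_def)
  have Xp: "qX ^ k \<noteq> 1" if "k > 0" for k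
  proof
    assume "qX ^ k = 1"
    then have "monom 1 k = (1 :: int poly)"
      by (metis to_fract_1 to_fract_eq_iff to_fract_monom)
    then show False using that by (metis degree_1 degree_monom_eq less_irrefl zero_neq_one)
  qed
  have X0: "qX \<noteq> 0" by (simp add: qX_def)
  have fV: "to_fract V = qX * (1 - qX) ^ 2"
    by (simp add: V_def f_power fX)
  have f4: "to_fract 4 = (4 :: int poly fract)"
  proof -
    have "to_fract (1 + 1 + 1 + 1) = (1 + 1 + 1 + 1 :: int poly fract)"
      by (simp only: to_fract_add to_fract_1)
    then show ?thesis by simp
  qed
  have fW: "to_fract W = 1 + qX - 4 * qX * qX ^ (2 * m) + qX * (1 + qX) * qX ^ (4 * m)"
    by (simp add: W_def f_power fX f4)
  have fprod: "to_fract (prod f I) = (\<Prod>i\<in>I. to_fract (f i))" for f :: "nat \<Rightarrow> int poly" and I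
    by (induction I rule: infinite_finite_induct) simp_all
  have fEv: "to_fract Ev = qpoch (qX ^ 2) (qX ^ 2) m"
    by (simp add: Ev_def fprod qpoch_def to_fract_monom power_mult power2_eq_square mult.assoc)
  have fOd: "to_fract Od = qpoch qX (qX ^ 2) m"
    by (simp add: Od_def fprod qpoch_def to_fract_monom power_mult)
  have "S = - to_fract W / to_fract V * (to_fract Od ^ 4 / to_fract Ev ^ 4)"
    using truncated_sum_closed_form[of qX m] X0 Xp qX_neq_1
    by (simp add: S_def q_int_def fV fW fEv fOd)
  moreover obtain A B where AB: "quot_of_fract S = (A, B)" by fastforce
  ultimately have "to_fract A / to_fract B = - to_fract W / to_fract V * (to_fract Od ^ 4 / to_fract Ev ^ 4)"
    using Fract_quot_of_fract[of S] by (simp add: Fract_conv_to_fract)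
  moreover have B0: "B \<noteq> 0" using AB snd_quot_of_fract_nonzero[of S] by simp
  moreover have V0: "V \<noteq> 0" by (simp add: V_def X_def one_pCons)
  moreover have monom_neq_1: "monom (1 :: int) k \<noteq> 1" if "k > 0" for k
    using Xp[OF that] by (metis to_fract_1 to_fract_monom)
  then have Ev0: "Ev \<noteq> 0" and Od0: "Od \<noteq> 0" by (auto simp: Ev_def Od_def)
  ultimately have "to_fract (A * V * Ev ^ 4) = to_fract (- W * B * Od ^ 4)"
    by (simp add: f_power field_simps)
  \<comment> \<open>With A / B the reduced form of the sum, clearing denominators leaves an identity
    of integer polynomials in which multiplicities can be compared.\<close>
  then have eq: "A * V * Ev ^ 4 = - W * B * Od ^ 4" by (simp only: to_fract_eq_iff)
  have cube: "[:-z, 1:] ^ 3 dvd cpoly A" if z: "z ^ n = 1" "z \<noteq> 1" for z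
  proof (cases "A = 0")
    case False
    have c_power: "cpoly (p ^ k) = cpoly p ^ k" for p k
      by (induction k) (simp_all add: cpoly_mult cpoly_1)
    have c0: "cpoly p \<noteq> 0 \<longleftrightarrow> p \<noteq> 0" for p using cpoly_inject[of p 0] by simp
    \<comment> \<open>\<open>W = 0\<close> would make the left side of \<open>eq\<close> vanish,
      although none of its factors is zero.\<close>
    have W0: "W \<noteq> 0" using eq False V0 Ev0 by auto
    have z0: "z \<noteq> 0" using z(1) assms(1) by (auto simp: power_0_left)
    have "cpoly V = [:0, 1:] * [:1, -1:] ^ 2"
      by (simp add: V_def X_def cpoly_mult c_power cpoly_diff cpoly_1 map_poly_pCons one_pCons)
    \<comment> \<open>The only roots of V are 0 and 1.\<close>
    then have ordV: "order z (cpoly V) = 0" using z0 z(2) by (intro order_0I) simp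
    have c_factor: "cpoly (1 - monom 1 k) = 1 - monom 1 k" for k
      by (simp only: cpoly_diff cpoly_1 cpoly_monom)
    have fact0: "1 - monom (1 :: complex) k \<noteq> 0" if "k > 0" for k
      using c0[of "1 - monom 1 k"] monom_neq_1[OF that] by (simp add: c_factor)
    have ord: "order z (cpoly (\<Prod>j<m. 1 - monom 1 (2 * j + r))) = card {j. j < m \<and> z ^ (2 * j + r) = 1}"
      if "r > 0" for r
    proof -
      have "order z (cpoly (\<Prod>j<m. 1 - monom 1 (2 * j + r)))
          = (\<Sum>j<m. of_bool (z ^ (2 * j + r) = 1))"
        unfolding cpoly_prod c_factor using that fact0
        by (subst order_prod) (simp_all add: order_one_minus_monom)
      also have "\<dots> = card ({..<m} \<inter> {j. z ^ (2 * j + r) = 1})" by simp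
      also have "{..<m} \<inter> {j. z ^ (2 * j + r) = 1} = {j. j < m \<and> z ^ (2 * j + r) = 1}" by auto
      finally show ?thesis .
    qed
    have less: "order z (cpoly Ev) < order z (cpoly Od)"
      unfolding Ev_def Od_def using odd_multiples_outnumber_even[OF assms z] ord[of 2] ord[of 1] by simp
    have "cpoly A * cpoly V * cpoly Ev ^ 4 = cpoly (- W) * cpoly B * cpoly Od ^ 4"
      using arg_cong[OF eq, of cpoly] by (simp only: cpoly_mult c_power)
    then have "order z (cpoly A * cpoly V * cpoly Ev ^ 4) = order z (cpoly (- W) * cpoly B * cpoly Od ^ 4)"
      by (rule arg_cong)
    moreover have "order z (p ^ 4) = 4 * order z p" if "p \<noteq> 0" for p :: "complex poly"
      using that by (simp add: eval_nat_numeral order_mult)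
    \<comment> \<open>W and B can only raise the multiplicity on the right, and V adds nothing on
      the left. The fourth powers turn a gap of at least one between \<open>Ev\<close> and
      \<open>Od\<close> into at least 4, which covers the cube.\<close>
    ultimately have "order z (cpoly A) + 4 * order z (cpoly Ev) \<ge> 4 * order z (cpoly Od)"
      using False V0 Ev0 W0 B0 Od0 ordV by (simp add: order_mult c0)
    then have "order z (cpoly A) \<ge> 3" using less by linarith
    then show ?thesis using order_1[of z "cpoly A"] by (rule power_le_dvd[rotated])
  qed simp
  have "finite {z :: complex. z ^ n = 1 \<and> z \<noteq> 1}"
    using finite_roots_unity[of n] assms(1) by (auto intro: finite_subset[rotated])
  then have "(\<Prod>z | z ^ n = 1 \<and> z \<noteq> 1. [:-z, 1:]) ^ 3 dvd cpoly A"
    by (rule prod_linear_power_dvd) (use cube in blast)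
  then have "cpoly (q_int_poly n) ^ 3 dvd cpoly A"
    using assms(1) by (simp add: cpoly_q_int_poly)
  moreover have "cpoly (q_int_poly n * cyclotomic n ^ 2) dvd cpoly (q_int_poly n) ^ 3"
    using cyclotomic_dvd_q_int_poly[OF assms(1)]
    by (simp add: cpoly_mult power2_eq_square power3_eq_cube mult_dvd_mono mult.assoc)
  ultimately have "cpoly (q_int_poly n * cyclotomic n ^ 2) dvd cpoly A" by (rule dvd_trans[rotated])
  \<comment> \<open>Over the complex numbers the modulus is a product of monic linear factors; being
    monic, it admits the descent to integer polynomials.\<close>
  moreover have "lead_coeff (q_int_poly n * cyclotomic n ^ 2) = 1"
  proof -
    have "lead_coeff (cpoly (q_int_poly n * cyclotomic n ^ 2)) = 1"
      using assms(1) by (simp add: cpoly_mult cpoly_q_int_poly of_int_cyclotomic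
          power2_eq_square lead_coeff_mult lead_coeff_prod)
    then show ?thesis by (simp add: degree_cpoly coeff_map_poly)
  qed
  ultimately have "q_int_poly n * cyclotomic n ^ 2 dvd A" by (intro dvd_of_cpoly_dvd)
  then show ?thesis using AB by (simp add: qcong_def S_def)
qed

end
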